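(* The equation $xy^2=y^2x$ (in the two free variables $x,y$) does not transfer.
   Context: An equation $\varphi$ holds virtually in a group $K$ (is a virtual law in $K$) if there is a finite index subgroup $L \leq K$ such that $\varphi(x_1,\dots,x_k)$ holds for all $x_1,\dots,x_k \in L$. An equation $\varphi$ in the language of group theory with $k$ free variables transfers (from cosets to subgroups) if for each group $G$ and subgroup $H<G$ (not necessarily proper) the following holds: if there are elements $g_1,\dots,g_k \in G$ such that $\varphi(x_1,\dots,x_k)$ holds for all $x_1 \in g_1H, \dots, x_k \in g_kH$, then $\varphi$ is a virtual law in $H$. *)

theory Defs
  imports "HOL-Algebra.Coset"
begin

datatype (term_vars: 'v) group_term =
    Var 'v
  | One
  | Inv "'v group_term"
  | Mult "'v group_term" "'v group_term"  (infixl "\<cdot>" 70)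

datatype (equation_vars: 'v) equation =
  Equation "'v group_term" "'v group_term"  (infix "\<doteq>" 50)

primrec eval_term :: "('a, 'm) monoid_scheme \<Rightarrow> ('v \<Rightarrow> 'a) \<Rightarrow> 'v group_term \<Rightarrow> 'a" where
  "eval_term G x (Var i) = x i"
| "eval_term G x One = \<one>\<^bsub>G\<^esub>"
| "eval_term G x (Inv s) = inv\<^bsub>G\<^esub> (eval_term G x s)"
| "eval_term G x (s \<cdot> t) = eval_term G x s \<otimes>\<^bsub>G\<^esub> eval_term G x t"

primrec holds_at :: "('a, 'm) monoid_scheme \<Rightarrow> 'v equation \<Rightarrow> ('v \<Rightarrow> 'a) \<Rightarrow> bool" where
  "holds_at G (s \<doteq> t) x \<longleftrightarrow> eval_term G x s = eval_term G x t"

definition virtual_law :: "('a, 'm) monoid_scheme \<Rightarrow> 'v equation \<Rightarrow> bool" where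
  "virtual_law K \<phi> \<longleftrightarrow>
     (\<exists>L. subgroup L K \<and> finite (rcosets\<^bsub>K\<^esub> L) \<and>
          (\<forall>x \<in> equation_vars \<phi> \<rightarrow> L. holds_at K \<phi> x))"

text \<open>
  HOL cannot quantify over all types inside a formula, so the groups in the following definition
  are those whose elements lie in a given type. A failure at any type is a failure of transfer
  in the usual sense, where the groups are arbitrary. At a finite type every equation transfers,
  because the trivial subgroup of a finite group has finite index.
\<close>
definition transfers :: "'a itself \<Rightarrow> 'v equation \<Rightarrow> bool" where
  "transfers (_ :: 'a itself) \<phi> \<longleftrightarrow>
     (\<forall>(G :: 'a monoid) H. group G \<longrightarrow> subgroup H G \<longrightarrow>
        (\<exists>g \<in> equation_vars \<phi> \<rightarrow> carrier G.
           \<forall>x \<in> (\<Pi> i \<in> equation_vars \<phi>. g i <#\<^bsub>G\<^esub> H). holds_at G \<phi> x) \<longrightarrow>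
        virtual_law (G\<lparr>carrier := H\<rparr>) \<phi>)"

end

theory Submission
  imports Defs "HOL-Algebra.Weak_Morphisms" "HOL-Library.Countable"
begin

text \<open>
  Let \<open>H\<close> be the integral Heisenberg group: triples of integers with
  \<open>(a, b, c) (a', b', c') = (a + a', b + b', c + c' + a b')\<close>, whose centre consists
  of the triples \<open>(0, 0, c)\<close>.
  The map \<open>\<sigma> (a, b, c) = (- a, - b, c)\<close> is an automorphism of order two that inverts \<open>H\<close> modulo the
  centre. In the semidirect product \<open>G = H \<rtimes> \<langle>\<sigma>\<rangle>\<close> one has \<open>(\<sigma> h)\<^sup>2 = \<sigma>(h) h\<close>, which is therefore
  central in \<open>H\<close>. So \<open>x y\<^sup>2 = y\<^sup>2 x\<close> holds for all \<open>x \<in> H\<close> and \<open>y \<in> \<sigma>H\<close>.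

  It is not a virtual law in \<open>H\<close>. A subgroup \<open>L\<close> of finite index contains, by the pigeonhole
  principle on cosets (\<open>finite_index_pow_mem\<close>), a positive power \<open>(n, 0, 0)\<close> of the first generator
  and \<open>(0, m, 0)\<close> of the second, and the commutator of \<open>(n, 0, 0)\<close> with the square of \<open>(0, m, 0)\<close>
  is \<open>(0, 0, 2 n m) \<noteq> (0, 0, 0)\<close>.

  This \<open>G\<close> is countable, so it has an isomorphic copy whose elements lie in any given infinite type.
  Since the truth of equations, cosets and finite index are invariant under isomorphism, the failure of
  transfer moves along the embedding (\<open>transfers_inj\<close>).
\<close>

section \<open>Equations and homomorphisms\<close>

lemma (in group_hom) eval_term_hom:
  assumes "\<forall>i \<in> term_vars t. x i \<in> carrier G"
  shows "eval_term G x t \<in> carrier G \<and> eval_term H (\<lambda>i. h (x i)) t = h (eval_term G x t)"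
  using assms by (induction t) auto

lemma (in group_hom) holds_at_inj_hom_iff:
  assumes "inj_on h (carrier G)" and "\<forall>i \<in> equation_vars \<phi>. x i \<in> carrier G"
  shows "holds_at H \<phi> (\<lambda>i. h (x i)) \<longleftrightarrow> holds_at G \<phi> x"
proof (cases \<phi>)
  case (Equation s t)
  then show ?thesis
    using assms eval_term_hom[of s x] eval_term_hom[of t x] by (auto dest: inj_onD)
qed

lemma holds_at_cong:
  assumes "\<And>i. i \<in> equation_vars \<phi> \<Longrightarrow> x i = y i"
  shows "holds_at G \<phi> x \<longleftrightarrow> holds_at G \<phi> y"
proof (cases \<phi>)
  case (Equation s t)
  have "eval_term G x u = eval_term G y u" if "\<forall>i \<in> term_vars u. x i = y i" for u
    using that by (induction u) auto
  then show ?thesis using Equation assms by auto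
qed

text \<open>
  The preimage of a finite index subgroup \<open>L\<close> satisfies the law by injectivity of \<open>h\<close>. Distinct cosets
  of the preimage lie over distinct cosets of \<open>L\<close>, so its index is finite as well.
\<close>
lemma (in group_hom) virtual_law_inj_hom:
  assumes inj: "inj_on h (carrier G)" and "virtual_law H \<phi>"
  shows "virtual_law G \<phi>"
proof -
  obtain L where L: "subgroup L H" and fin: "finite (rcosets\<^bsub>H\<^esub> L)"
    and law: "\<And>x. x \<in> equation_vars \<phi> \<rightarrow> L \<Longrightarrow> holds_at H \<phi> x"
    using assms unfolding virtual_law_def by blast
  interpret L: subgroup L H by (rule L)
  define M where "M = {x \<in> carrier G. h x \<in> L}"
  have M: "subgroup M G"
    unfolding M_def by (rule G.subgroupI) (auto intro!: exI[of _ "\<one>\<^bsub>G\<^esub>"])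
  interpret M: subgroup M G by (rule M)
  have coset_eq: "M #>\<^bsub>G\<^esub> x = M #>\<^bsub>G\<^esub> y"
    if x: "x \<in> carrier G" and y: "y \<in> carrier G" and eq: "L #>\<^bsub>H\<^esub> h x = L #>\<^bsub>H\<^esub> h y" for x y
  proof -
    have "h y \<in> L #>\<^bsub>H\<^esub> h x"
      using H.rcos_self[OF _ L, of "h y"] y eq by simp
    then have "h y \<otimes>\<^bsub>H\<^esub> inv\<^bsub>H\<^esub> (h x) \<in> L"
      using L.rcos_module_imp[OF H.group_axioms] x by simp
    then have "y \<otimes>\<^bsub>G\<^esub> inv\<^bsub>G\<^esub> x \<in> M"
      unfolding M_def using x y by auto
    then have "y \<in> M #>\<^bsub>G\<^esub> x"
      using M.rcos_module_rev[OF G.group_axioms] x y by simp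
    then show ?thesis
      using G.repr_independence[OF _ x M] by simp
  qed
  \<comment> \<open>A chosen representative avoids showing that \<open>M x \<mapsto> L (h x)\<close> is well defined.\<close>
  define rep where "rep C = (SOME x. x \<in> carrier G \<and> C = M #>\<^bsub>G\<^esub> x)" for C
  have rep: "rep C \<in> carrier G \<and> C = M #>\<^bsub>G\<^esub> rep C" if "C \<in> rcosets\<^bsub>G\<^esub> M" for C
    unfolding rep_def by (rule someI_ex) (use that in \<open>auto simp: RCOSETS_def\<close>)
  have "finite (rcosets\<^bsub>G\<^esub> M)"
  proof (rule inj_on_finite[OF _ _ fin])
    show "inj_on (\<lambda>C. L #>\<^bsub>H\<^esub> h (rep C)) (rcosets\<^bsub>G\<^esub> M)"
      by (rule inj_onI) (metis rep coset_eq)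
    show "(\<lambda>C. L #>\<^bsub>H\<^esub> h (rep C)) ` (rcosets\<^bsub>G\<^esub> M) \<subseteq> rcosets\<^bsub>H\<^esub> L"
      using rep by (force simp: RCOSETS_def[of H])
  qed
  moreover have "holds_at G \<phi> x" if x_M: "x \<in> equation_vars \<phi> \<rightarrow> M" for x
  proof -
    have x: "x i \<in> carrier G \<and> h (x i) \<in> L" if i: "i \<in> equation_vars \<phi>" for i
    proof -
      have "x i \<in> M" by (rule Pi_mem[OF x_M i])
      then show ?thesis unfolding M_def by (rule CollectD)
    qed
    then have "holds_at H \<phi> (\<lambda>i. h (x i))"
      by (intro law Pi_I) simp
    moreover have "\<forall>i \<in> equation_vars \<phi>. x i \<in> carrier G"
      using x by simp
    ultimately show ?thesis
      using holds_at_inj_hom_iff[OF inj, of \<phi> x] by simp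
  qed
  ultimately show ?thesis
    unfolding virtual_law_def using M by blast
qed

section \<open>Transfer and the size of the type\<close>

lemma (in group) group_hom_image_group:
  assumes "inj_on f (carrier G)"
  shows "group_hom G (image_group f G) f"
proof (rule weak_group_morphism_group_hom)
  show "weak_group_morphism f {\<one>} G"
  proof (rule weak_group_morphismsI[OF one_is_normal])
    fix a b assume ab: "a \<in> carrier G" "b \<in> carrier G"
    then have "a \<otimes> inv b = \<one> \<longleftrightarrow> a = b"
      using inv_solve_right'[of \<one> a b] by auto
    then show "f a = f b \<longleftrightarrow> a \<otimes> inv b \<in> {\<one>}"
      using assms ab by (simp add: inj_on_eq_iff)
  qed
qed

text \<open>
  A group with elements in the smaller type is isomorphic to its image in the larger one, and a
  solution of the hypothesis of transfer in the group can be pushed forward to that image. The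
  resulting virtual law of the image subgroup is then pulled back along the isomorphism.
\<close>
lemma transfers_inj:
  fixes f :: "'b \<Rightarrow> 'a" and \<phi> :: "'v equation"
  assumes f: "inj f" and transfers: "transfers TYPE('a) \<phi>"
  shows "transfers TYPE('b) \<phi>"
  unfolding transfers_def
proof (intro allI impI)
  fix G :: "'b monoid" and H
  assume G: "group G" and H: "subgroup H G"
    and "\<exists>g \<in> equation_vars \<phi> \<rightarrow> carrier G.
      \<forall>x \<in> (\<Pi> i \<in> equation_vars \<phi>. g i <#\<^bsub>G\<^esub> H). holds_at G \<phi> x"
  then obtain g where g: "g \<in> equation_vars \<phi> \<rightarrow> carrier G"
    and law: "\<And>x. x \<in> (\<Pi> i \<in> equation_vars \<phi>. g i <#\<^bsub>G\<^esub> H) \<Longrightarrow> holds_at G \<phi> x"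
    by blast
  define G' where "G' = image_group f G"
  have inj: "inj_on f A" for A
    using f by (rule inj_on_subset) simp
  interpret f: group_hom G G' f
    unfolding G'_def using group.group_hom_image_group[OF G inj] .
  interpret H: subgroup H G by (rule H)
  have H': "subgroup (f ` H) G'"
    by (rule f.subgroup_img_is_subgroup[OF H])
  have "holds_at G' \<phi> x'" if x': "x' \<in> (\<Pi> i \<in> equation_vars \<phi>. f (g i) <#\<^bsub>G'\<^esub> (f ` H))" for x'
  proof -
    define x where "x i = inv_into UNIV f (x' i)" for i
    have x: "x i \<in> g i <#\<^bsub>G\<^esub> H \<and> x i \<in> carrier G \<and> x' i = f (x i)" if i: "i \<in> equation_vars \<phi>" for i
    proof -
      obtain k where k: "k \<in> H" "x' i = f (g i) \<otimes>\<^bsub>G'\<^esub> f k"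
        using Pi_mem[OF x' i] by (auto simp: l_coset_def)
      have "g i \<in> carrier G" using g i by blast
      then have "x' i = f (g i \<otimes>\<^bsub>G\<^esub> k)" using k by simp
      moreover from this have "x i = g i \<otimes>\<^bsub>G\<^esub> k"
        using f by (simp add: x_def)
      ultimately show ?thesis
        using k \<open>g i \<in> carrier G\<close> by (auto simp: l_coset_def)
    qed
    then have "holds_at G \<phi> x" by (intro law Pi_I) simp
    then have "holds_at G' \<phi> (\<lambda>i. f (x i))"
      using f.holds_at_inj_hom_iff[OF inj, of \<phi> x] x by simp
    moreover have "holds_at G' \<phi> x' \<longleftrightarrow> holds_at G' \<phi> (\<lambda>i. f (x i))"
      by (rule holds_at_cong) (simp add: x)
    ultimately show ?thesis by simp
  qed
  then have "\<forall>x \<in> (\<Pi> i \<in> equation_vars \<phi>. f (g i) <#\<^bsub>G'\<^esub> (f ` H)). holds_at G' \<phi> x"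
    by (rule ballI)
  moreover have "(\<lambda>i. f (g i)) \<in> equation_vars \<phi> \<rightarrow> carrier G'"
    using Pi_mem[OF g] by (intro Pi_I f.hom_closed)
  ultimately have "\<exists>g' \<in> equation_vars \<phi> \<rightarrow> carrier G'.
      \<forall>x \<in> (\<Pi> i \<in> equation_vars \<phi>. g' i <#\<^bsub>G'\<^esub> (f ` H)). holds_at G' \<phi> x"
    by (rule bexI)
  then have virtual: "virtual_law (G'\<lparr>carrier := f ` H\<rparr>) \<phi>"
    by (rule transfers[unfolded transfers_def, rule_format, OF f.H.group_axioms H'])
  interpret fH: group_hom "G\<lparr>carrier := H\<rparr>" "G'\<lparr>carrier := f ` H\<rparr>" f
    using f.G.subgroup_imp_group[OF H] f.H.subgroup_imp_group[OF H']
    by (auto simp: group_hom_def group_hom_axioms_def hom_def)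
  show "virtual_law (G\<lparr>carrier := H\<rparr>) \<phi>"
    by (rule fH.virtual_law_inj_hom[OF inj virtual])
qed

section \<open>Powers in subgroups of finite index\<close>

text \<open>
  Two of the cosets \<open>L x\<^sup>i\<close> coincide, as there are only finitely many, and the quotient of the
  two powers lies in \<open>L\<close>.
\<close>
lemma (in group) finite_index_pow_mem:
  assumes L: "subgroup L G" and fin: "finite (rcosets L)" and x: "x \<in> carrier G"
  shows "\<exists>n::nat > 0. x [^] n \<in> L"
proof -
  interpret L: subgroup L G by (rule L)
  have "range (\<lambda>i::nat. L #> x [^] i) \<subseteq> rcosets L"
    using x by (auto simp: RCOSETS_def)
  then have "\<not> inj (\<lambda>i::nat. L #> x [^] i)"
    using fin finite_subset finite_imageD infinite_UNIV_nat by blast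
  then obtain i j :: nat where ij: "i < j" and eq: "L #> x [^] i = L #> x [^] j"
    by (metis (mono_tags, lifting) injI linorder_neqE_nat)
  have "x [^] j \<in> L #> x [^] i"
    using rcos_self[OF _ L, of "x [^] j"] x eq by simp
  then have "x [^] j \<otimes> inv (x [^] i) \<in> L"
    using L.rcos_module_imp[OF group_axioms] x by simp
  moreover have "x [^] j = x [^] (j - i) \<otimes> x [^] i"
    using x ij by (simp add: nat_pow_mult)
  ultimately have "x [^] (j - i) \<in> L"
    using x by (simp add: m_assoc)
  then show ?thesis using ij by (intro exI[of _ "j - i"]) simp
qed

section \<open>The Heisenberg group with an inverting involution\<close>

text \<open>
  The quadruple \<open>(a, b, c, e)\<close> stands for \<open>(a, b, c) \<sigma>\<close> or \<open>(a, b, c)\<close> according as the sign \<open>e\<close>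
  is \<open>- 1\<close> or \<open>1\<close>; moving that sign past a factor \<open>(a', b', c')\<close> multiplies \<open>a'\<close> and \<open>b'\<close> by \<open>e\<close>.
\<close>
definition heisenberg_ext :: "(int \<times> int \<times> int \<times> int) monoid" where
  "heisenberg_ext =
     \<lparr>carrier = {(a, b, c, e). e = 1 \<or> e = - 1},
      mult = (\<lambda>(a, b, c, e) (a', b', c', e').
        (a + e * a', b + e * b', c + c' + e * a * b', e * e')),
      one = (0, 0, 0, 1)\<rparr>"

definition heisenberg :: "(int \<times> int \<times> int \<times> int) set" where
  "heisenberg = {(a, b, c, e). e = 1}"

lemma heisenberg_ext_simps [simp]:
  "(a, b, c, e) \<in> carrier heisenberg_ext \<longleftrightarrow> e = 1 \<or> e = - 1"
  "(a, b, c, e) \<otimes>\<^bsub>heisenberg_ext\<^esub> (a', b', c', e') =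
     (a + e * a', b + e * b', c + c' + e * a * b', e * e')"
  "\<one>\<^bsub>heisenberg_ext\<^esub> = (0, 0, 0, 1)"
  by (auto simp: heisenberg_ext_def)

lemma group_heisenberg_ext: "group heisenberg_ext"
proof (rule groupI)
  fix x assume "x \<in> carrier heisenberg_ext"
  then obtain a b c e where x: "x = (a, b, c, e)" "e = 1 \<or> e = - 1"
    by (cases x) auto
  then show "\<exists>y \<in> carrier heisenberg_ext. y \<otimes>\<^bsub>heisenberg_ext\<^esub> x = \<one>\<^bsub>heisenberg_ext\<^esub>"
    by (intro bexI[of _ "(- e * a, - e * b, - c + a * b, e)"]) auto
qed (auto simp: algebra_simps)

lemma inv_heisenberg_ext:
  assumes "e = 1 \<or> e = - 1"
  shows "inv\<^bsub>heisenberg_ext\<^esub> (a, b, c, e) = (- e * a, - e * b, - c + a * b, e)"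
  by (rule group.inv_equality[OF group_heisenberg_ext]) (use assms in auto)

lemma subgroup_heisenberg: "subgroup heisenberg heisenberg_ext"
  by (rule group.subgroupI[OF group_heisenberg_ext])
    (auto simp: heisenberg_def inv_heisenberg_ext)

text \<open>
  The law holds on the cosets \<open>H\<close> for \<open>x\<close> and \<open>\<sigma>H\<close> for \<open>y\<close>. A subgroup \<open>L\<close> of finite index
  contains powers of both generators of \<open>H\<close>, and these violate it.
\<close>
lemma not_transfers_heisenberg:
  "\<not> transfers TYPE(int \<times> int \<times> int \<times> int)
      (Var (0::nat) \<cdot> (Var 1 \<cdot> Var 1) \<doteq> (Var 1 \<cdot> Var 1) \<cdot> Var 0)"
    (is "\<not> transfers _ ?\<phi>")
proof
  assume transfers: "transfers TYPE(int \<times> int \<times> int \<times> int) ?\<phi>"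
  let ?H = "heisenberg_ext\<lparr>carrier := heisenberg\<rparr>"
  define g :: "nat \<Rightarrow> int \<times> int \<times> int \<times> int"
    where "g i = (if i = 0 then (0, 0, 0, 1) else (0, 0, 0, - 1))" for i
  have "holds_at heisenberg_ext ?\<phi> x"
    if x: "x \<in> (\<Pi> i \<in> equation_vars ?\<phi>. g i <#\<^bsub>heisenberg_ext\<^esub> heisenberg)" for x
  proof -
    have "x 0 \<in> g 0 <#\<^bsub>heisenberg_ext\<^esub> heisenberg" "x 1 \<in> g 1 <#\<^bsub>heisenberg_ext\<^esub> heisenberg"
      using x by auto
    then obtain a b c a' b' c' where "x 0 = (a, b, c, 1)" "x 1 = (a', b', c', - 1)"
      by (auto simp: g_def l_coset_def heisenberg_def)
    then show ?thesis by simp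
  qed
  moreover have "g \<in> equation_vars ?\<phi> \<rightarrow> carrier heisenberg_ext"
    by (auto simp: g_def)
  ultimately have "virtual_law ?H ?\<phi>"
    using transfers group_heisenberg_ext subgroup_heisenberg unfolding transfers_def by blast
  then obtain L where L: "subgroup L ?H" and fin: "finite (rcosets\<^bsub>?H\<^esub> L)"
    and law: "\<And>x. x \<in> equation_vars ?\<phi> \<rightarrow> L \<Longrightarrow> holds_at ?H ?\<phi> x"
    unfolding virtual_law_def by blast
  interpret H: group ?H
    by (rule group.subgroup_imp_group[OF group_heisenberg_ext subgroup_heisenberg])
  have pow_x: "(1, 0, 0, 1) [^]\<^bsub>?H\<^esub> n = (int n, 0, 0, 1)" for n :: nat
    by (induction n) simp_all
  have pow_y: "(0, 1, 0, 1) [^]\<^bsub>?H\<^esub> n = (0, int n, 0, 1)" for n :: nat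
    by (induction n) simp_all
  obtain n :: nat where n: "n > 0" "(int n, 0, 0, 1) \<in> L"
    using H.finite_index_pow_mem[OF L fin, of "(1, 0, 0, 1)"] pow_x by (auto simp: heisenberg_def)
  obtain m :: nat where m: "m > 0" "(0, int m, 0, 1) \<in> L"
    using H.finite_index_pow_mem[OF L fin, of "(0, 1, 0, 1)"] pow_y by (auto simp: heisenberg_def)
  have "holds_at ?H ?\<phi> (\<lambda>i. if i = 0 then (int n, 0, 0, 1) else (0, int m, 0, 1))"
    using n m by (intro law) auto
  then show False using n m by simp
qed

theorem proposition2p21:
  assumes "infinite (UNIV :: 'a set)"
  shows "\<not> transfers TYPE('a)
            (Var (0::nat) \<cdot> (Var 1 \<cdot> Var 1) \<doteq> (Var 1 \<cdot> Var 1) \<cdot> Var 0)"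
proof -
  obtain k :: "nat \<Rightarrow> 'a" where "inj k"
    using infinite_countable_subset[OF assms] by blast
  then have "inj (k \<circ> (to_nat :: int \<times> int \<times> int \<times> int \<Rightarrow> nat))"
    by (intro inj_compose) simp_all
  then show ?thesis
    using transfers_inj not_transfers_heisenberg by blast
qed

end
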